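(* For every integer $k \geq 4$, the graph $C_{2k}^*$ is a minimal non-UDG; that is, it is not a unit disk graph, but every proper induced subgraph of it is a unit disk graph.
   Context: All graphs are finite and simple. A graph $G=(V,E)$ is a unit disk graph (UDG) if there is a function $f:V\to\mathbb{R}^2$ such that for distinct $u,v\in V$, $uv\in E$ if and only if the Euclidean distance between $f(u)$ and $f(v)$ is at most $1$. For a bipartite graph $G=(U,W,E)$ with fixed bipartition into independent sets $U$ and $W$, $G^*$ denotes the graph obtained from $G$ by making each of $U$ and $W$ a clique and leaving the edges between $U$ and $W$ unchanged. $C_{2k}$ is the cycle on $2k$ vertices with its (unique) bipartition. *)

theory Defs
  imports "Graph_Theory.Digraph_Component" "HOL-Analysis.Analysis"
begin

text \<open>
  Finite simple graphs are rendered as in \<^theory>\<open>Graph_Theory.Digraph\<close>: finite, loop-free,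
  symmetric digraphs without parallel arcs (locale \<^locale>\<open>graph\<close>).  An edge \<open>uv\<close> is the pair of
  arcs \<open>(u, v)\<close>, \<open>(v, u)\<close>.
\<close>

definition unit_disk_graph :: "('a, 'b) pre_digraph \<Rightarrow> bool" where
  "unit_disk_graph G \<longleftrightarrow> graph G \<and>
     (\<exists>f :: 'a \<Rightarrow> real ^ 2. \<forall>u\<in>verts G. \<forall>v\<in>verts G. u \<noteq> v \<longrightarrow>
        ((u, v) \<in> arcs_ends G \<longleftrightarrow> dist (f u) (f v) \<le> 1))"

definition minimal_non_udg :: "('a, 'b) pre_digraph \<Rightarrow> bool" where
  "minimal_non_udg G \<longleftrightarrow> graph G \<and> \<not> unit_disk_graph G \<and>
     (\<forall>H. induced_subgraph H G \<and> H \<noteq> G \<longrightarrow> unit_disk_graph H)"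

definition bipartition :: "'a pair_pre_digraph \<Rightarrow> 'a set \<Rightarrow> 'a set \<Rightarrow> bool" where
  "bipartition G U W \<longleftrightarrow> U \<union> W = pverts G \<and> U \<inter> W = {} \<and>
     parcs G \<inter> U \<times> U = {} \<and> parcs G \<inter> W \<times> W = {}"

text \<open>The graph \<open>G\<^sup>*\<close> of a graph \<open>G\<close> with bipartition \<open>U\<close>, \<open>W\<close>.\<close>

definition clique_closure :: "'a pair_pre_digraph \<Rightarrow> 'a set \<Rightarrow> 'a set \<Rightarrow> 'a pair_pre_digraph" where
  "clique_closure G U W =
     \<lparr>pverts = pverts G,
      parcs = parcs G \<union> {(u, v) \<in> U \<times> U. u \<noteq> v} \<union> {(u, v) \<in> W \<times> W. u \<noteq> v}\<rparr>"

text \<open>This is the cycle \<open>C\<^sub>n\<close> only for \<open>n \<ge> 3\<close>.\<close>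

definition cycle_graph :: "nat \<Rightarrow> nat pair_pre_digraph" where
  "cycle_graph n =
     \<lparr>pverts = {..<n},
      parcs = {(i, j). i < n \<and> j < n \<and> (j = (i + 1) mod n \<or> i = (j + 1) mod n)}\<rparr>"

lemma pair_graph_cycle_graph:
  assumes "n \<ge> 3"
  shows "pair_graph (cycle_graph n)"
proof unfold_locales
  have "parcs (cycle_graph n) \<subseteq> {..<n} \<times> {..<n}"
    by (auto simp: cycle_graph_def)
  then show "finite (parcs (cycle_graph n))"
    by (rule finite_subset) auto
  show "fst e \<noteq> snd e" if "e \<in> parcs (cycle_graph n)" for e
    using that assms by (auto simp: cycle_graph_def mod_Suc split: if_splits)
qed (auto simp: cycle_graph_def symmetric_def sym_def)

lemma pair_graph_clique_closure:
  assumes "pair_graph G" "bipartition G U W"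
  shows "pair_graph (clique_closure G U W)"
proof -
  interpret pair_graph G by fact
  have sub: "U \<subseteq> pverts G" "W \<subseteq> pverts G"
    using assms(2) by (auto simp: bipartition_def)
  show ?thesis
  proof unfold_locales
    have "parcs (clique_closure G U W) \<subseteq> pverts G \<times> pverts G"
      using sub by (auto simp: clique_closure_def dest: in_arcsD1 in_arcsD2)
    then show "finite (parcs (clique_closure G U W))"
      by (rule finite_subset) auto
    show "symmetric (with_proj (clique_closure G U W))"
      by (auto simp: clique_closure_def symmetric_def sym_def intro: arcs_symmetric)
  qed (use sub in \<open>auto simp: clique_closure_def dest: in_arcsD1 in_arcsD2 no_loops'\<close>)
qed

text \<open>Existence and uniqueness (up to order) of the bipartition of an even cycle.\<close>

lemma bipartition_cycle_graph_iff:
  assumes "k \<ge> 2"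
  shows "bipartition (cycle_graph (2 * k)) U W \<longleftrightarrow>
    {U, W} = {{i. i < 2 * k \<and> even i}, {i. i < 2 * k \<and> odd i}}"
    (is "_ \<longleftrightarrow> {U, W} = {?E, ?O}")
proof
  assume B: "bipartition (cycle_graph (2 * k)) U W"
  have UW: "U \<union> W = {..<2 * k}" "U \<inter> W = {}"
    using B by (auto simp: bipartition_def cycle_graph_def)
  have step: "Suc i \<in> U \<longleftrightarrow> i \<notin> U" if "Suc i < 2 * k" for i
  proof -
    have "(i, Suc i) \<in> parcs (cycle_graph (2 * k))"
      using that by (simp add: cycle_graph_def)
    then have "\<not> (i \<in> U \<and> Suc i \<in> U)" "\<not> (i \<in> W \<and> Suc i \<in> W)"
      using B by (auto simp: bipartition_def)
    moreover have "i \<in> U \<union> W" "Suc i \<in> U \<union> W"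
      using that UW(1) by auto
    ultimately show ?thesis by auto
  qed
  have par: "i \<in> U \<longleftrightarrow> (even i \<longleftrightarrow> 0 \<in> U)" if "i < 2 * k" for i
    using that by (induction i) (auto simp: step)
  have U: "U = {i. i < 2 * k \<and> (even i \<longleftrightarrow> 0 \<in> U)}"
    using par UW(1) by blast
  have W: "W = {i. i < 2 * k \<and> (even i \<longleftrightarrow> 0 \<notin> U)}"
    using par UW by blast
  show "{U, W} = {?E, ?O}"
  proof (cases "0 \<in> U")
    case True
    then have "U = ?E" "W = ?O" using U W by auto
    then show ?thesis by simp
  next
    case False
    then have "U = ?O" "W = ?E" using U W by auto
    then show ?thesis by auto
  qed
next
  assume "{U, W} = {?E, ?O}"
  then have "U = ?E \<and> W = ?O \<or> U = ?O \<and> W = ?E"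
    by (auto simp: doubleton_eq_iff)
  moreover have "even i \<longleftrightarrow> odd j"
    if "(i, j) \<in> parcs (cycle_graph (2 * k))" for i j
    using that assms
    by (auto simp: cycle_graph_def mod_Suc split: if_splits) (metis dvd_triv_left even_Suc)+
  ultimately show "bipartition (cycle_graph (2 * k)) U W"
    by (auto simp: bipartition_def cycle_graph_def)
qed

end

(* An induced C4 in a unit disk graph is drawn as a convex quadrilateral. Any two edges of the cycle
   at cyclic distance at least 3 span such a C4, so the line through an edge has all vertices not
   adjacent to that edge on one side; let s i be that side for the edge (i, i + 1), indices modulo 2k.
   Comparing the two sides within one C4 gives s (i + 3) = s i and s (i + 4) = - s i, according to
   the parities of the end points. Hence s 12 equals both s 0 and - s 0.

   Conversely, deleting a vertex leaves a path, whose vertices can be placed alternately on two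
   parallel lines, with equal small steps e in the direction of the lines: the distance of the lines
   is chosen such that a single step gives distance exactly 1. *)
theory Submission
  imports Defs
begin

section \<open>Plane geometry of induced 4-cycles\<close>

text \<open>Twice the signed area of the triangle \<open>p\<close>, \<open>q\<close>,
  \<open>r\<close>; its sign is the side of the directed line \<open>pq\<close> on which
  \<open>r\<close> lies.\<close>

definition orient :: "real ^ 2 \<Rightarrow> real ^ 2 \<Rightarrow> real ^ 2 \<Rightarrow> real" where
  "orient p q r = (q $ 1 - p $ 1) * (r $ 2 - p $ 2) - (q $ 2 - p $ 2) * (r $ 1 - p $ 1)"

lemma orient_flip: "orient q p r = - orient p q r"
  by (simp add: orient_def algebra_simps)

lemma dist_le_1_iff_vec2:
  fixes p q :: "real ^ 2"
  shows "dist p q \<le> 1 \<longleftrightarrow> (p $ 1 - q $ 1)\<^sup>2 + (p $ 2 - q $ 2)\<^sup>2 \<le> 1"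
  by (simp add: dist_vec_def L2_set_def sum_2 dist_real_def)

text \<open>Coordinates relative to a segment \<open>ac\<close> with \<open>\<bar>c - a\<bar>\<^sup>2 = N\<close>, scaled by \<open>\<bar>c - a\<bar>\<close> to avoid
  square roots: \<open>a\<close> is \<open>(0, 0)\<close>, \<open>c\<close> is \<open>(N, 0)\<close> and the unit distance becomes \<open>sqrt N\<close>.\<close>

lemma half_lens_diameter:
  fixes X Y Z W N :: real
  assumes "N > 1" "X\<^sup>2 + Y\<^sup>2 \<le> N" "(N - X)\<^sup>2 + Y\<^sup>2 \<le> N"
    and "Z\<^sup>2 + W\<^sup>2 \<le> N" "(N - Z)\<^sup>2 + W\<^sup>2 \<le> N" "Y * W \<ge> 0"
  shows "(X - Z)\<^sup>2 + (Y - W)\<^sup>2 \<le> N"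
proof -
  \<comment> \<open>The point nearer to the line projects into the segment. Hence its offset from
    the other point is bounded, in each coordinate, by the offset of that other point from one end
    of the segment.\<close>
  have lower: "(X - Z)\<^sup>2 + (Y - W)\<^sup>2 \<le> N"
    if X: "X\<^sup>2 + Y\<^sup>2 \<le> N" "(N - X)\<^sup>2 + Y\<^sup>2 \<le> N"
      and Z: "Z\<^sup>2 + W\<^sup>2 \<le> N" "(N - Z)\<^sup>2 + W\<^sup>2 \<le> N"
      and YW: "Y * W \<ge> 0" "\<bar>Y\<bar> \<le> \<bar>W\<bar>" for X Y Z W :: real
  proof -
    have "N \<le> N\<^sup>2" using \<open>N > 1\<close> by (simp add: power2_eq_square)
    moreover have "X\<^sup>2 \<le> N" "(N - X)\<^sup>2 \<le> N"
      using X by (smt (verit) zero_le_power2)+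
    ultimately have "X\<^sup>2 \<le> N\<^sup>2" "(N - X)\<^sup>2 \<le> N\<^sup>2" by linarith+
    then have X01: "0 \<le> X" "X \<le> N"
      using \<open>N > 1\<close> abs_le_square_iff[of X N] abs_le_square_iff[of "N - X" N] by linarith+
    have Y: "(Y - W)\<^sup>2 \<le> W\<^sup>2"
      using YW by (intro iffD1[OF abs_le_square_iff]) (auto simp: zero_le_mult_iff)
    show ?thesis
    proof (cases "X \<le> Z")
      case True
      then have "(X - Z)\<^sup>2 \<le> Z\<^sup>2"
        using X01 by (intro iffD1[OF abs_le_square_iff]) auto
      then show ?thesis using Y Z by linarith
    next
      case False
      then have "(X - Z)\<^sup>2 \<le> (N - Z)\<^sup>2"
        using X01 by (intro iffD1[OF abs_le_square_iff]) auto
      then show ?thesis using Y Z by linarith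
    qed
  qed
  show ?thesis
  proof (cases "\<bar>Y\<bar> \<le> \<bar>W\<bar>")
    case True
    then show ?thesis using assms by (intro lower) auto
  next
    case False
    then have "(Z - X)\<^sup>2 + (W - Y)\<^sup>2 \<le> N"
      using assms by (intro lower) (auto simp: mult.commute)
    then show ?thesis by (simp add: power2_commute)
  qed
qed

text \<open>Otherwise \<open>b\<close> and \<open>d\<close> lie in one closed half of the lens of
  the unit disks around \<open>a\<close> and \<open>c\<close>, cut along \<open>ac\<close>; as
  \<open>dist a c > 1\<close>, that half has diameter at most 1.\<close>

lemma unit_C4_diagonal_separates:
  fixes a b c d :: "real ^ 2"
  assumes "dist a b \<le> 1" "dist b c \<le> 1" "dist c d \<le> 1" "dist d a \<le> 1"
    and "dist a c > 1" "dist b d > 1"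
  shows "orient a c b * orient a c d < 0"
proof (rule ccontr)
  define n1 n2 where "n1 = c $ 1 - a $ 1" and "n2 = c $ 2 - a $ 2"
  define N where "N = n1\<^sup>2 + n2\<^sup>2"
  \<comment> \<open>Inner and cross product with \<open>c - a\<close> give the scaled coordinates of
    \<open>half_lens_diameter\<close>.\<close>
  define ip where "ip p q = n1 * (q $ 1 - p $ 1) + n2 * (q $ 2 - p $ 2)" for p q :: "real ^ 2"
  define cp where "cp p q = n1 * (q $ 2 - p $ 2) - n2 * (q $ 1 - p $ 1)" for p q :: "real ^ 2"
  have N: "N > 1"
    using assms(5) dist_le_1_iff_vec2[of c a] by (simp add: N_def n1_def n2_def dist_commute)
  have lagrange: "dist p q \<le> 1 \<longleftrightarrow> (ip p q)\<^sup>2 + (cp p q)\<^sup>2 \<le> N" for p q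
  proof -
    have "(ip p q)\<^sup>2 + (cp p q)\<^sup>2 = N * ((p $ 1 - q $ 1)\<^sup>2 + (p $ 2 - q $ 2)\<^sup>2)"
      by (simp add: ip_def cp_def N_def power2_eq_square algebra_simps)
    then show ?thesis
      using N by (simp add: dist_le_1_iff_vec2)
  qed
  have "ip x c = N - ip a x" "cp x c = - cp a x" for x
    by (simp_all add: ip_def cp_def N_def n1_def n2_def power2_eq_square algebra_simps)
  moreover have "orient a c x = cp a x" for x
    by (simp add: orient_def cp_def n1_def n2_def)
  moreover assume "\<not> orient a c b * orient a c d < 0"
  ultimately have "(ip a b - ip a d)\<^sup>2 + (cp a b - cp a d)\<^sup>2 \<le> N"
    using assms(1-4) lagrange[of a b] lagrange[of b c] lagrange[of d c] lagrange[of a d] N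
    by (intro half_lens_diameter) (auto simp: dist_commute)
  also have "ip a b - ip a d = ip d b"
    by (simp add: ip_def algebra_simps)
  also have "cp a b - cp a d = cp d b"
    by (simp add: cp_def algebra_simps)
  finally show False
    using lagrange[of d b] assms(6) by (simp add: dist_commute)
qed

text \<open>Each diagonal separates the other two vertices, so the four triangles agree in sign in
  pairs. Cutting along either diagonal gives the same signed area, so the two pairs agree as
  well.\<close>

lemma unit_C4_convex:
  fixes a b c d :: "real ^ 2"
  assumes "dist a b \<le> 1" "dist b c \<le> 1" "dist c d \<le> 1" "dist d a \<le> 1"
    and "dist a c > 1" "dist b d > 1"
  shows "orient a b c \<noteq> 0" and "sgn (orient a b d) = sgn (orient a b c)"
    and "sgn (orient c d a) = sgn (orient a b c)"
proof -
  have "orient a c b * orient a c d < 0"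
    using assms by (rule unit_C4_diagonal_separates)
  moreover have "orient b d c * orient b d a < 0"
    using assms by (intro unit_C4_diagonal_separates) (auto simp: dist_commute)
  moreover have "orient a c b = - orient a b c" "orient a c d = orient c d a"
    "orient b d c = - orient b c d" "orient b d a = orient a b d"
    "orient a b c + orient c d a = orient b c d + orient a b d"
    by (simp_all add: orient_def algebra_simps)
  ultimately have "orient a b c \<noteq> 0 \<and> sgn (orient a b d) = sgn (orient a b c) \<and>
    sgn (orient c d a) = sgn (orient a b c)"
    by (auto simp: mult_less_0_iff zero_less_mult_iff sgn_if)
  then show "orient a b c \<noteq> 0" "sgn (orient a b d) = sgn (orient a b c)"
    "sgn (orient c d a) = sgn (orient a b c)" by blast+
qed

section \<open>The full cycle has no embedding\<close>

definition even_cycle_star_adj :: "nat \<Rightarrow> nat \<Rightarrow> nat \<Rightarrow> bool" where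
  "even_cycle_star_adj k i j \<longleftrightarrow>
     (even i \<longleftrightarrow> even j) \<or> j = Suc i mod (2 * k) \<or> i = Suc j mod (2 * k)"

lemma even_mod_double: "even (n mod (2 * k)) \<longleftrightarrow> even (n :: nat)"
  by (metis dvd_mod_iff dvd_triv_left)

text \<open>Removes \<open>mod\<close> from adjacency checks: within one period after
  \<open>m\<close>, a difference divisible by \<open>2 * k\<close> can only be 0 or
  \<open>2 * k\<close>.\<close>

lemma even_cycle_star_adj_mod:
  assumes "m < n" "n < m + 2 * k"
  shows "even_cycle_star_adj k (m mod (2 * k)) (n mod (2 * k)) \<longleftrightarrow>
    (even m \<longleftrightarrow> even n) \<or> n = Suc m \<or> Suc n = m + 2 * k"
proof -
  have "n mod (2 * k) = Suc m mod (2 * k) \<longleftrightarrow> 2 * k dvd n - Suc m"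
    using assms by (intro mod_eq_dvd_iff_nat) auto
  also have "\<dots> \<longleftrightarrow> n = Suc m"
    using assms by (auto dest: dvd_imp_le)
  finally have 1: "n mod (2 * k) = Suc m mod (2 * k) \<longleftrightarrow> n = Suc m" .
  have "Suc n mod (2 * k) = m mod (2 * k) \<longleftrightarrow> 2 * k dvd Suc n - m"
    using assms by (intro mod_eq_dvd_iff_nat) auto
  also have "\<dots> \<longleftrightarrow> Suc n = m + 2 * k"
  proof
    assume "2 * k dvd Suc n - m"
    then have "2 * k \<le> Suc n - m" using assms by (intro dvd_imp_le) auto
    then show "Suc n = m + 2 * k" using assms by linarith
  qed auto
  finally have 2: "m mod (2 * k) = Suc n mod (2 * k) \<longleftrightarrow> Suc n = m + 2 * k" by auto
  show ?thesis
    unfolding even_cycle_star_adj_def mod_Suc_eq even_mod_double 1 2 ..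
qed

lemma no_unit_disk_embedding_even_cycle_star:
  fixes f :: "nat \<Rightarrow> real ^ 2"
  assumes k: "k \<ge> 4"
    and f: "\<And>i j. i < 2 * k \<Longrightarrow> j < 2 * k \<Longrightarrow> i \<noteq> j \<Longrightarrow>
      even_cycle_star_adj k i j \<longleftrightarrow> dist (f i) (f j) \<le> 1"
  shows False
proof -
  define F where "F n = f (n mod (2 * k))" for n
  have F: "dist (F m) (F n) \<le> 1 \<longleftrightarrow> (even m \<longleftrightarrow> even n) \<or> n = Suc m \<or> Suc n = m + 2 * k"
    if "m < n" "n < m + 2 * k" for m n
  proof -
    have "m mod (2 * k) \<noteq> n mod (2 * k)"
    proof
      assume "m mod (2 * k) = n mod (2 * k)"
      then have "2 * k dvd n - m"
        using that mod_eq_dvd_iff_nat[of m n "2 * k"] by simp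
      then show False using that by (auto dest: dvd_imp_le)
    qed
    then show ?thesis
      using f[of "m mod (2 * k)" "n mod (2 * k)"] k
      by (simp add: F_def even_cycle_star_adj_mod[OF that])
  qed
  have F': "dist (F n) (F m) \<le> 1 \<longleftrightarrow> (even m \<longleftrightarrow> even n) \<or> n = Suc m \<or> Suc n = m + 2 * k"
    if "m < n" "n < m + 2 * k" for m n
    using F[OF that] by (simp add: dist_commute)
  \<comment> \<open>The vertices \<open>i + 3\<close>, ..., \<open>i + 2 * k - 2\<close> are those
    on edges at cyclic distance at least 3; \<open>side\<close> shows that \<open>i + 3\<close>
    represents them all.\<close>
  define s where "s i = sgn (orient (F i) (F (Suc i)) (F (i + 3)))" for i
  have side_Suc: "sgn (orient (F i) (F (Suc i)) (F (Suc x))) = sgn (orient (F i) (F (Suc i)) (F x))"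
    if "i + 3 \<le> x" "Suc x \<le> i + 2 * k - 2" for i x
  \<comment> \<open>Parity decides whether \<open>x\<close> or \<open>Suc x\<close> follows
    \<open>Suc i\<close> on the 4-cycle; the bounds on \<open>x\<close> keep its diagonals
    nonadjacent.\<close>
  proof (cases "even i \<longleftrightarrow> even x")
    case True
    show ?thesis
      by (rule unit_C4_convex(2)[of _ "F (Suc i)", symmetric])
        (use that k True in \<open>auto simp: F F' not_le[symmetric]\<close>)
  next
    case False
    show ?thesis
      by (rule unit_C4_convex(2)) (use that k False in \<open>auto simp: F F' not_le[symmetric]\<close>)
  qed
  have side: "sgn (orient (F i) (F (Suc i)) (F x)) = s i"
    if "i + 3 \<le> x" "x \<le> i + 2 * k - 2" for i x
    using that
  proof (induction x rule: dec_induct)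
    case (step x)
    then show ?case using side_Suc[of i x] by simp
  qed (simp add: s_def)
  have period: "F (n + 2 * k) = F n" for n by (simp add: F_def)
  \<comment> \<open>The 4-cycle \<open>i\<close>, \<open>i + 1\<close>, \<open>i + 3\<close>,
    \<open>i + 4\<close> runs through both edges forwards. Seen from \<open>i + 3\<close>, vertex
    \<open>i\<close> has index \<open>i + 2 * k\<close>.\<close>
  have s3: "s (i + 3) = s i" "s i \<noteq> 0" for i
  proof -
    have "orient (F i) (F (Suc i)) (F (i + 3)) \<noteq> 0"
      by (rule unit_C4_convex(1)[where d = "F (i + 4)"])
        (use k in \<open>auto simp: F F' not_le[symmetric]\<close>)
    then show "s i \<noteq> 0" by (simp add: s_def sgn_eq_0_iff)
    have "sgn (orient (F (i + 3)) (F (i + 4)) (F i)) = sgn (orient (F i) (F (Suc i)) (F (i + 3)))"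
      by (rule unit_C4_convex(3)) (use k in \<open>auto simp: F F' not_le[symmetric]\<close>)
    then show "s (i + 3) = s i"
      using side[of "i + 3" "i + 2 * k"] period[of i] k by (simp add: s_def eval_nat_numeral)
  qed
  \<comment> \<open>Now \<open>i + 1\<close> is followed by \<open>i + 5\<close>, so the second edge
    is run through backwards, which flips the sign. That \<open>i + 5\<close> stays within the range
    of \<open>side\<close> needs \<open>k \<ge> 4\<close>.\<close>
  have s4: "s (i + 4) = - s i" for i
  proof -
    have "sgn (orient (F (i + 5)) (F (i + 4)) (F i)) = sgn (orient (F i) (F (Suc i)) (F (i + 5)))"
      by (rule unit_C4_convex(3)) (use k in \<open>auto simp: F F' not_le[symmetric]\<close>)
    also have "\<dots> = s i" using side[of i "i + 5"] k by simp
    finally show ?thesis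
      using side[of "i + 4" "i + 2 * k"] period[of i] k orient_flip[of "F (i + 5)" "F (i + 4)" "F i"]
      by (simp add: sgn_minus eval_nat_numeral)
  qed
  have "s 12 = s 0"
    using s3(1)[of 0] s3(1)[of 3] s3(1)[of 6] s3(1)[of 9] by simp
  moreover have "s 12 = - s 0"
    using s4[of 0] s4[of 4] s4[of 8] by simp
  ultimately show False using s3(2)[of 0] by simp
qed

section \<open>Drawing the cycle without one vertex\<close>

lemma unit_disk_embedding_path_star:
  fixes n :: nat
  obtains g :: "int \<Rightarrow> real ^ 2" where
    "\<And>p q. p \<noteq> q \<Longrightarrow> \<bar>p - q\<bar> \<le> int n \<Longrightarrow>
      dist (g p) (g q) \<le> 1 \<longleftrightarrow> (even p \<longleftrightarrow> even q) \<or> \<bar>p - q\<bar> = 1"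
proof
  \<comment> \<open>Up to \<open>n\<close> steps along one line then stay below length 1;
    \<open>Suc n\<close> keeps \<open>e\<close> positive for \<open>n = 0\<close>.\<close>
  define e :: real where "e = 1 / real (Suc n)"
  define g :: "int \<Rightarrow> real ^ 2"
    where "g p = vector [e * of_int p, if even p then 0 else sqrt (1 - e\<^sup>2)]" for p
  have e: "e > 0" "e \<le> 1" by (simp_all add: e_def)
  have e2: "e\<^sup>2 \<le> 1" using e by (simp add: power_le_one)
  fix p q :: int
  assume pq: "p \<noteq> q" "\<bar>p - q\<bar> \<le> int n"
  define t where "t = \<bar>real_of_int p - of_int q\<bar>"
  have sq: "(e * of_int p - e * of_int q)\<^sup>2 = e\<^sup>2 * t\<^sup>2"
    by (simp add: t_def power_mult_distrib flip: right_diff_distrib)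
  have t: "t = real_of_int \<bar>p - q\<bar>" by (simp add: t_def)
  show "dist (g p) (g q) \<le> 1 \<longleftrightarrow> (even p \<longleftrightarrow> even q) \<or> \<bar>p - q\<bar> = 1"
  proof (cases "even p \<longleftrightarrow> even q")
    case True
    have "t \<le> real n" using pq(2) t by linarith
    then have "e * t \<le> 1" by (simp add: e_def field_simps)
    then have "(e * t)\<^sup>2 \<le> 1" using e by (intro power_le_one) (auto simp: t_def)
    then show ?thesis
      using True by (auto simp: dist_le_1_iff_vec2 g_def sq power_mult_distrib)
  next
    case False
    have "dist (g p) (g q) \<le> 1 \<longleftrightarrow> e\<^sup>2 * t\<^sup>2 + (1 - e\<^sup>2) \<le> 1"
      using False e2 by (auto simp: dist_le_1_iff_vec2 g_def sq)
    also have "\<dots> \<longleftrightarrow> t\<^sup>2 \<le> 1" using e by simp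
    also have "\<dots> \<longleftrightarrow> t \<le> 1" by (simp add: abs_square_le_1 t_def)
    also have "\<dots> \<longleftrightarrow> \<bar>p - q\<bar> \<le> 1" unfolding t by (rule of_int_le_1_iff)
    also have "\<dots> \<longleftrightarrow> \<bar>p - q\<bar> = 1" using pq(1) by auto
    finally show ?thesis using False by simp
  qed
qed

lemma unit_disk_embedding_even_cycle_star_delete:
  assumes "v < 2 * k"
  obtains f :: "nat \<Rightarrow> real ^ 2" where
    "\<And>i j. i < 2 * k \<Longrightarrow> j < 2 * k \<Longrightarrow> i \<noteq> v \<Longrightarrow> j \<noteq> v \<Longrightarrow> i \<noteq> j \<Longrightarrow>
      even_cycle_star_adj k i j \<longleftrightarrow> dist (f i) (f j) \<le> 1"
proof -
  obtain g :: "int \<Rightarrow> real ^ 2" where g: "\<And>p q. p \<noteq> q \<Longrightarrow> \<bar>p - q\<bar> \<le> int (2 * k) \<Longrightarrow>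
      dist (g p) (g q) \<le> 1 \<longleftrightarrow> (even p \<longleftrightarrow> even q) \<or> \<bar>p - q\<bar> = 1"
    using unit_disk_embedding_path_star[of "2 * k"] by blast
  \<comment> \<open>Cutting at \<open>v\<close> unrolls the rest to \<open>v + 1\<close>, ...,
    \<open>v + 2 * k - 1\<close>. The even shift preserves parity.\<close>
  define pos where "pos i = (if v < i then int i else int i + 2 * int k)" for i
  show thesis
  proof (rule that[of "g \<circ> pos"])
    fix i j
    assume ij: "i < 2 * k" "j < 2 * k" "i \<noteq> v" "j \<noteq> v" "i \<noteq> j"
    have "pos i \<noteq> pos j" "\<bar>pos i - pos j\<bar> \<le> int (2 * k)"
      using ij assms by (auto simp: pos_def)
    moreover have "even (pos i) \<longleftrightarrow> even i" for i by (simp add: pos_def)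
    moreover have "j = Suc i mod (2 * k) \<or> i = Suc j mod (2 * k) \<longleftrightarrow> \<bar>pos i - pos j\<bar> = 1"
      if "even i \<noteq> even j"
      using ij assms by (auto simp: pos_def mod_Suc split: if_splits)
    ultimately show "even_cycle_star_adj k i j \<longleftrightarrow> dist ((g \<circ> pos) i) ((g \<circ> pos) j) \<le> 1"
      by (auto simp: g even_cycle_star_adj_def)
  qed
qed

section \<open>Transfer to the graphs\<close>

lemma arcs_clique_closure_cycle_graph:
  assumes "k \<ge> 2" "bipartition (cycle_graph (2 * k)) U W"
    and "i < 2 * k" "j < 2 * k" "i \<noteq> j"
  shows "(i, j) \<in> parcs (clique_closure (cycle_graph (2 * k)) U W) \<longleftrightarrow> even_cycle_star_adj k i j"
proof -
  have "{U, W} = {{i. i < 2 * k \<and> even i}, {i. i < 2 * k \<and> odd i}}"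
    using assms(1,2) by (simp add: bipartition_cycle_graph_iff)
  then have "(i \<in> U \<and> j \<in> U \<or> i \<in> W \<and> j \<in> W) \<longleftrightarrow> (even i \<longleftrightarrow> even j)"
    using assms(3,4) by (auto simp: doubleton_eq_iff)
  then show ?thesis
    using assms(3-5) by (auto simp: clique_closure_def cycle_graph_def even_cycle_star_adj_def)
qed

lemma (in graph) graph_induced_subgraph:
  assumes "induced_subgraph H G"
  shows "graph H"
  using digraphI_induced[OF assms] induced_graph_imp_graph[OF assms]
  by (simp add: graph_def pseudo_graph_def digraph_def)

theorem theorem8:
  fixes k :: nat and U W :: "nat set"
  assumes "k \<ge> 4"
    and "bipartition (cycle_graph (2 * k)) U W"
  shows "minimal_non_udg (with_proj (clique_closure (cycle_graph (2 * k)) U W))"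
proof -
  define P where "P = clique_closure (cycle_graph (2 * k)) U W"
  interpret P: pair_graph P
    unfolding P_def using assms by (intro pair_graph_clique_closure pair_graph_cycle_graph) auto
  have verts: "pverts P = {..<2 * k}"
    by (simp add: P_def clique_closure_def cycle_graph_def)
  have arcs: "(i, j) \<in> parcs P \<longleftrightarrow> even_cycle_star_adj k i j"
    if "i < 2 * k" "j < 2 * k" "i \<noteq> j" for i j
    unfolding P_def using assms that by (intro arcs_clique_closure_cycle_graph) auto
  have "\<not> unit_disk_graph (with_proj P)"
  proof
    assume "unit_disk_graph (with_proj P)"
    then obtain f :: "nat \<Rightarrow> real ^ 2" where "\<And>i j. i < 2 * k \<Longrightarrow> j < 2 * k \<Longrightarrow> i \<noteq> j \<Longrightarrow>
        even_cycle_star_adj k i j \<longleftrightarrow> dist (f i) (f j) \<le> 1"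
      by (auto simp: unit_disk_graph_def verts arcs)
    with assms(1) show False by (rule no_unit_disk_embedding_even_cycle_star)
  qed
  moreover have "unit_disk_graph H" if H: "induced_subgraph H (with_proj P)" "H \<noteq> with_proj P" for H
  proof -
    have sub: "verts H \<subseteq> {..<2 * k}" "tail H = fst" "head H = snd"
      and arcs_H: "arcs H = {e \<in> parcs P. fst e \<in> verts H \<and> snd e \<in> verts H}"
      using H(1) by (auto simp: induced_subgraph_def subgraph_def compatible_def verts)
    \<comment> \<open>Vertices determine an induced subgraph, so a proper one misses some
      \<open>v\<close>.\<close>
    have "verts H \<noteq> {..<2 * k}"
    proof
      assume "verts H = {..<2 * k}"
      moreover from this have "arcs H = parcs P"
        unfolding arcs_H using P.in_arcsD1 P.in_arcsD2 verts by auto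
      ultimately have "H = with_proj P"
        using sub verts by (intro pre_digraph.equality) auto
      with H(2) show False ..
    qed
    with sub obtain v where v: "v < 2 * k" "v \<notin> verts H" by auto
    \<comment> \<open>A drawing of all vertices but \<open>v\<close> restricts to every induced
      subgraph avoiding \<open>v\<close>.\<close>
    obtain f :: "nat \<Rightarrow> real ^ 2" where f: "\<And>i j. i < 2 * k \<Longrightarrow> j < 2 * k \<Longrightarrow> i \<noteq> v \<Longrightarrow> j \<noteq> v \<Longrightarrow> i \<noteq> j \<Longrightarrow>
      even_cycle_star_adj k i j \<longleftrightarrow> dist (f i) (f j) \<le> 1"
      using unit_disk_embedding_even_cycle_star_delete[OF v(1)] by blast
    have "(i, j) \<in> arcs_ends H \<longleftrightarrow> dist (f i) (f j) \<le> 1"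
      if "i \<in> verts H" "j \<in> verts H" "i \<noteq> j" for i j
    proof -
      have "i < 2 * k" "j < 2 * k" "i \<noteq> v" "j \<noteq> v" using that sub v by auto
      then show ?thesis
        using that f[of i j] arcs[of i j] by (simp add: arcs_ends_conv sub arcs_H)
    qed
    moreover have "graph H" using H(1) by (rule P.graph_induced_subgraph)
    ultimately show ?thesis by (auto simp: unit_disk_graph_def)
  qed
  moreover have "graph (with_proj P)" by unfold_locales
  ultimately show ?thesis by (auto simp: minimal_non_udg_def P_def)
qed

end
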